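(* Let $q_0>0$, $d_0>0$, $\sigma>0$ and let $x<q_0$. For $b\in[0,1]$ let $Q^{(b)}=(Q^{(b)}_t)_{t\geqslant 0}$ be the solution of $$\mathrm{d}Q_t = -\frac{d_0Q_t}{1+bd_0t}\,\mathrm{d}t + \sigma\,\mathrm{d}B_t,\qquad Q_0=q_0,$$ where $(B_t)$ is a standard Brownian motion, and let $T_{Q,x}(b)=\inf\{t\geqslant 0: Q^{(b)}_t\leqslant x\}=\inf\{t\geqslant 0: Q^{(b)}_t=x\}$ be the hitting time of level $x$. If $b_1\leqslant b_2$ (with $b_1,b_2\in[0,1]$), then $T_{Q,x}(b_1)\preceq_{st}T_{Q,x}(b_2)$.
   Context: For random variables $X,Y$, $X\preceq_{st}Y$ (usual stochastic order) means $\mathbb{P}[X>t]\leqslant\mathbb{P}[Y>t]$ for all $t\in\mathbb{R}$. The SDE is in the Itô sense and has a unique strong solution with continuous paths; for $b=0$ its drift is $-d_0Q_t\,\mathrm{d}t$. The mean $\mathbb{E}[Q^{(b)}_t]=q_0(1+bd_0t)^{-1/b}$ (read as $q_0e^{-d_0t}$ for $b=0$) is the Arps decline curve with initial production rate $q_0$, shape parameter $b$ and parameter $d_0$.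
   Formalization: The level is additionally assumed to satisfy x ≥ 0; for x < 0 the claim can fail, e.g. q_0 = d_0 = σ = 1, b_1 = 0, b_2 = 1, x = -10, where P[T(0) > 100] > 0.99 but P[T(1) > 100] < 0.96. *)

theory Defs
  imports "HOL-Probability.Probability"
begin

text \<open>
  Time is a real number; only times \<open>t \<ge> 0\<close> are constrained, and the members of the
  filtration at negative times play no role.  The filtration may be the augmented filtration
  generated by \<open>B\<close>, or any larger one for which \<open>B\<close> is still a Brownian motion.
\<close>

definition standard_brownian_motion ::
    "'a measure \<Rightarrow> (real \<Rightarrow> 'a measure) \<Rightarrow> (real \<Rightarrow> 'a \<Rightarrow> real) \<Rightarrow> bool" where
  "standard_brownian_motion M F B \<longleftrightarrow>
     prob_space M \<and>
     filtration (space M) F \<and>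
     (\<forall>t. subalgebra M (F t)) \<and>
     (\<forall>t\<ge>0. B t \<in> borel_measurable (F t)) \<and>
     (AE \<omega> in M. B 0 \<omega> = 0) \<and>
     (AE \<omega> in M. continuous_on {0..} (\<lambda>t. B t \<omega>)) \<and>
     (\<forall>s t. 0 \<le> s \<longrightarrow> s < t \<longrightarrow>
        distributed M lborel (\<lambda>\<omega>. B t \<omega> - B s \<omega>) (normal_density 0 (sqrt (t - s))) \<and>
        prob_space.indep_set M (sets (F s))
          (sets (vimage_algebra (space M) (\<lambda>\<omega>. B t \<omega> - B s \<omega>) borel)))"

text \<open>
  \<open>X\<close> is a solution, with continuous paths, of
  \<open>dX\<^sub>t = \<mu>(t, X\<^sub>t) dt + \<sigma> dB\<^sub>t\<close>, \<open>X\<^sub>0 = x\<^sub>0\<close>, with constant \<open>\<sigma>\<close>.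
  The Ito integral of a constant (a simple process) over \<open>[0,t]\<close> is by definition
  \<open>\<sigma> (B\<^sub>t - B\<^sub>0)\<close>.
\<close>

definition solves_additive_sde ::
    "'a measure \<Rightarrow> (real \<Rightarrow> 'a measure) \<Rightarrow> (real \<Rightarrow> 'a \<Rightarrow> real) \<Rightarrow>
     (real \<Rightarrow> real \<Rightarrow> real) \<Rightarrow> real \<Rightarrow> real \<Rightarrow> (real \<Rightarrow> 'a \<Rightarrow> real) \<Rightarrow> bool" where
  "solves_additive_sde M F B \<mu> \<sigma> x0 X \<longleftrightarrow>
     (\<forall>t\<ge>0. X t \<in> borel_measurable (F t)) \<and>
     (\<forall>\<omega>\<in>space M. continuous_on {0..} (\<lambda>t. X t \<omega>)) \<and>
     (AE \<omega> in M. \<forall>t\<ge>0.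
        set_integrable lborel {0..t} (\<lambda>s. \<mu> s (X s \<omega>)) \<and>
        X t \<omega> = x0 + (LBINT s:{0..t}. \<mu> s (X s \<omega>)) + \<sigma> * (B t \<omega> - B 0 \<omega>))"

definition hitting_time :: "(real \<Rightarrow> 'a \<Rightarrow> real) \<Rightarrow> real \<Rightarrow> 'a \<Rightarrow> ereal" where
  "hitting_time X x \<omega> = (INF t\<in>{t. 0 \<le> t \<and> X t \<omega> \<le> x}. ereal t)"

lemma hitting_time_eq:
  assumes cont: "continuous_on {0..} (\<lambda>t. X t \<omega>)" and start: "x \<le> X 0 \<omega>"
  shows "hitting_time X x \<omega> = (INF t\<in>{t. 0 \<le> t \<and> X t \<omega> = x}. ereal t)"
  unfolding hitting_time_def
proof (rule antisym)
  show "(INF t\<in>{t. 0 \<le> t \<and> X t \<omega> \<le> x}. ereal t) \<le> (INF t\<in>{t. 0 \<le> t \<and> X t \<omega> = x}. ereal t)"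
    by (rule INF_superset_mono) auto
  show "(INF t\<in>{t. 0 \<le> t \<and> X t \<omega> = x}. ereal t) \<le> (INF t\<in>{t. 0 \<le> t \<and> X t \<omega> \<le> x}. ereal t)"
  proof (rule INF_mono)
    fix t assume "t \<in> {t. 0 \<le> t \<and> X t \<omega> \<le> x}"
    then have t: "0 \<le> t" "X t \<omega> \<le> x" by auto
    have "continuous_on {0..t} (\<lambda>t. X t \<omega>)"
      by (rule continuous_on_subset[OF cont]) auto
    then obtain s where "0 \<le> s" "s \<le> t" "X s \<omega> = x"
      using IVT2'[of "\<lambda>t. X t \<omega>" t x 0] t start by auto
    then show "\<exists>s\<in>{t. 0 \<le> t \<and> X t \<omega> = x}. ereal s \<le> ereal t"
      by (intro bexI[of _ s]) auto
  qed
qed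

text \<open>
  The usual stochastic order.  Values in \<open>ereal\<close> accommodate hitting times, which may be
  \<open>\<infinity>\<close>; measurability is part of the definition because \<^const>\<open>measure\<close> is 0 on
  non-measurable sets.
\<close>

definition stochastic_le :: "'a measure \<Rightarrow> ('a \<Rightarrow> ereal) \<Rightarrow> 'b measure \<Rightarrow> ('b \<Rightarrow> ereal) \<Rightarrow> bool" where
  "stochastic_le M X N Y \<longleftrightarrow>
     X \<in> borel_measurable M \<and> Y \<in> borel_measurable N \<and>
     (\<forall>t::real. measure M {\<omega>\<in>space M. X \<omega> > ereal t} \<le> measure N {\<omega>\<in>space N. Y \<omega> > ereal t})"

end

theory Submission
  imports Defs
begin

text \<open>
  Both solutions are driven by the same Brownian path, so the noise cancels in their difference,
  and the comparison is pathwise.  As long as \<open>Q\<^sub>1\<close> stays above \<open>x \<ge> 0\<close> it is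
  positive, and wherever \<open>Q\<^sub>2 < Q\<^sub>1\<close> the drift of \<open>Q\<^sub>2\<close> is then at least that
  of \<open>Q\<^sub>1\<close>; hence \<open>Q\<^sub>2\<close> cannot fall below \<open>Q\<^sub>1\<close> before
  \<open>Q\<^sub>1\<close> reaches \<open>x\<close>, and the hitting times are almost surely ordered.
\<close>

text \<open>Let \<open>s\<close> be the last time in \<open>{0..T}\<close> with
  \<open>u s \<le> v s\<close>. After \<open>s\<close> the inequality \<open>v < u\<close> holds,
  hence \<open>f \<le> g\<close>, so \<open>u - v\<close> cannot grow on \<open>{s<..T}\<close>: the
  common term \<open>n\<close> cancels. No regularity of \<open>n\<close> or Lipschitz bound
  enters.\<close>

lemma integral_equation_comparison:
  fixes u v f g n :: "real \<Rightarrow> real"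
  assumes contu: "continuous_on {0..T} u" and contv: "continuous_on {0..T} v"
    and intf: "\<And>t. t \<in> {0..T} \<Longrightarrow> set_integrable lborel {0..t} f"
    and intg: "\<And>t. t \<in> {0..T} \<Longrightarrow> set_integrable lborel {0..t} g"
    and u: "\<And>t. t \<in> {0..T} \<Longrightarrow> u t = c + (LBINT s:{0..t}. f s) + n t"
    and v: "\<And>t. t \<in> {0..T} \<Longrightarrow> v t = c + (LBINT s:{0..t}. g s) + n t"
    and le: "\<And>t. t \<in> {0..T} \<Longrightarrow> v t < u t \<Longrightarrow> f t \<le> g t"
    and T: "0 \<le> T"
  shows "u T \<le> v T"
proof (rule ccontr)
  assume "\<not> u T \<le> v T"
  then have neg: "v T < u T" by simp
  define Z where "Z = {t \<in> {0..T}. u t \<le> v t}"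
  \<comment> \<open>A singleton is Lebesgue null, so both equations give the value
    \<open>c + n 0\<close> at time 0; hence \<open>Z\<close> is nonempty.\<close>
  have "(LBINT s:{0..0}. h s) = 0" for h :: "real \<Rightarrow> real"
    unfolding set_lebesgue_integral_def using AE_lborel_singleton[of 0]
    by (intro integral_eq_zero_AE) (auto elim!: eventually_mono)
  then have "u 0 = v 0"
    using u[of 0] v[of 0] T by simp
  then have "0 \<in> Z"
    using T by (auto simp: Z_def)
  have "closed Z"
    unfolding Z_def by (intro continuous_on_closed_Collect_le contu contv) auto
  moreover have "bounded Z"
    by (rule bounded_subset[of "{0..T}"]) (auto simp: Z_def)
  ultimately have "compact Z"
    by (simp add: compact_eq_bounded_closed)
  then obtain s where "s \<in> Z" and last: "\<And>r. r \<in> Z \<Longrightarrow> r \<le> s"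
    using compact_attains_sup[of Z] \<open>0 \<in> Z\<close> by auto
  then have s: "0 \<le> s" "s \<le> T" "u s \<le> v s"
    by (auto simp: Z_def)
  have after: "f r \<le> g r" if "r \<in> {s<..T}" for r
    using last[of r] le[of r] that s by (force simp: Z_def)
  have split: "{0..T} = {0..s} \<union> {s<..T}" "{0..s} \<inter> {s<..T} = {}"
    using s by auto
  have intf': "set_integrable lborel {s<..T} f" and intg': "set_integrable lborel {s<..T} g"
    using s by (auto intro!: set_integrable_subset[OF intf[of T]] set_integrable_subset[OF intg[of T]])
  have "(LBINT r:{0..T}. f r) = (LBINT r:{0..s}. f r) + (LBINT r:{s<..T}. f r)"
    unfolding split(1) using s by (intro set_integral_Un split intf' intf) auto
  moreover have "(LBINT r:{0..T}. g r) = (LBINT r:{0..s}. g r) + (LBINT r:{s<..T}. g r)"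
    unfolding split(1) using s by (intro set_integral_Un split intg' intg) auto
  moreover have "(LBINT r:{s<..T}. f r) \<le> (LBINT r:{s<..T}. g r)"
    by (rule set_integral_mono[OF intf' intg' after])
  ultimately have "u T - u s \<le> v T - v s"
    using u[of T] u[of s] v[of T] v[of s] s by simp
  then show False
    using neg s by simp
qed

text \<open>
  The clamped times \<open>min (max 0 r) t\<close> with \<open>r\<close> rational are dense in \<open>[0, t]\<close>, also when \<open>t = 0\<close>.
\<close>

lemma ex_le_iff_rational_approx:
  fixes f :: "real \<Rightarrow> real"
  assumes cont: "continuous_on {0..} f" and t: "0 \<le> t"
  shows "(\<exists>s\<in>{0..t}. f s \<le> x) \<longleftrightarrow>
    (\<forall>n::nat. \<exists>r::rat. f (min (max 0 (of_rat r)) t) < x + 1 / Suc n)"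
proof
  assume "\<exists>s\<in>{0..t}. f s \<le> x"
  then obtain s where s: "0 \<le> s" "s \<le> t" "f s \<le> x" by auto
  show "\<forall>n::nat. \<exists>r::rat. f (min (max 0 (of_rat r)) t) < x + 1 / Suc n"
  proof
    fix n :: nat
    have pos: "0 < 1 / real (Suc n)" by simp
    with cont s obtain d where d: "d > 0"
      "\<And>r. 0 \<le> r \<Longrightarrow> dist r s < d \<Longrightarrow> dist (f r) (f s) < 1 / Suc n"
      unfolding continuous_on_iff by (metis atLeast_iff)
    \<comment> \<open>Clamping moves this \<open>r\<close> no further from \<open>s\<close>: it
      either stays put or drops to \<open>t\<close>, which lies between \<open>s\<close> and
      \<open>r\<close>.\<close>
    obtain r where r: "s < of_rat r" "of_rat r < s + d"
      using of_rat_dense[of s "s + d"] d(1) by auto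
    have "dist (min (max 0 (of_rat r)) t) s < d"
      using r s by (auto simp: dist_real_def)
    then have "dist (f (min (max 0 (of_rat r)) t)) (f s) < 1 / Suc n"
      using t by (intro d) auto
    then show "\<exists>r::rat. f (min (max 0 (of_rat r)) t) < x + 1 / Suc n"
      using s by (intro exI[of _ r]) (auto simp: dist_real_def)
  qed
next
  \<comment> \<open>The minimum of \<open>f\<close> over the compact interval is attained and lies
    below \<open>x + 1 / Suc n\<close> for every \<open>n\<close>.\<close>
  assume approx: "\<forall>n::nat. \<exists>r::rat. f (min (max 0 (of_rat r)) t) < x + 1 / Suc n"
  obtain s where s: "s \<in> {0..t}" "\<And>r. r \<in> {0..t} \<Longrightarrow> f s \<le> f r"
    using continuous_attains_inf[of "{0..t}" f] continuous_on_subset[OF cont, of "{0..t}"] t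
    by auto
  have "f s \<le> x"
  proof (rule ccontr)
    assume "\<not> f s \<le> x"
    then obtain n where n: "1 / Suc n < f s - x"
      using nat_approx_posE[of "f s - x"] by auto
    obtain r :: rat where "f (min (max 0 (of_rat r)) t) < x + 1 / Suc n"
      using approx by blast
    then show False
      using n s(2)[of "min (max 0 (of_rat r)) t"] t by simp
  qed
  then show "\<exists>s\<in>{0..t}. f s \<le> x"
    using s(1) by blast
qed

text \<open>The infimum ranges over uncountably many times. Path continuity reduces the event that
  it is less than \<open>a\<close> to countable unions and intersections of events at single
  times.\<close>

lemma borel_measurable_hitting_time:
  fixes X :: "real \<Rightarrow> 'a \<Rightarrow> real"
  assumes meas: "\<And>t. 0 \<le> t \<Longrightarrow> X t \<in> borel_measurable M"
    and cont: "\<And>\<omega>. \<omega> \<in> space M \<Longrightarrow> continuous_on {0..} (\<lambda>t. X t \<omega>)"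
  shows "hitting_time X x \<in> borel_measurable M"
proof (rule borel_measurableI_less)
  fix a :: ereal
  have "hitting_time X x \<omega> < a \<longleftrightarrow>
      (\<exists>q::rat. 0 \<le> q \<and> ereal (of_rat q) < a \<and>
        (\<forall>n::nat. \<exists>r::rat. X (min (max 0 (of_rat r)) (of_rat q)) \<omega> < x + 1 / Suc n))"
    if "\<omega> \<in> space M" for \<omega>
  proof -
    have "hitting_time X x \<omega> < a \<longleftrightarrow> (\<exists>s\<ge>0. X s \<omega> \<le> x \<and> ereal s < a)"
      by (auto simp: hitting_time_def INF_less_iff)
    also have "\<dots> \<longleftrightarrow> (\<exists>q::rat. 0 \<le> q \<and> ereal (of_rat q) < a \<and> (\<exists>s\<in>{0..of_rat q}. X s \<omega> \<le> x))"
    proof (intro iffI; elim exE conjE bexE)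
      fix s assume s: "0 \<le> s" "X s \<omega> \<le> x" "ereal s < a"
      \<comment> \<open>The strict inequality leaves room for a rational horizon \<open>q\<close>
        beyond \<open>s\<close>, which makes the union over horizons countable.\<close>
      obtain q where q: "ereal s < ereal (of_rat q)" "ereal (of_rat q) < a"
        using ereal_dense3[OF s(3)] by auto
      then have "0 < (of_rat q :: real)"
        using s(1) by (simp del: zero_less_of_rat_iff)
      then show "\<exists>q::rat. 0 \<le> q \<and> ereal (of_rat q) < a \<and> (\<exists>s\<in>{0..of_rat q}. X s \<omega> \<le> x)"
        using q s by (intro exI[of _ q]) auto
    next
      fix q :: rat and s assume "ereal (of_rat q) < a" "s \<in> {0..of_rat q}" "X s \<omega> \<le> x"
      then show "\<exists>s\<ge>0. X s \<omega> \<le> x \<and> ereal s < a"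
        by (intro exI[of _ s]) (auto intro: le_less_trans[of "ereal s" "ereal (of_rat q)"])
    qed
    also have "\<dots> \<longleftrightarrow> (\<exists>q::rat. 0 \<le> q \<and> ereal (of_rat q) < a \<and>
        (\<forall>n::nat. \<exists>r::rat. X (min (max 0 (of_rat r)) (of_rat q)) \<omega> < x + 1 / Suc n))"
      using ex_le_iff_rational_approx[OF cont[OF that]] by (intro ex_cong1 conj_cong) auto
    finally show ?thesis .
  qed
  then have "{\<omega>\<in>space M. hitting_time X x \<omega> < a} =
      (\<Union>q\<in>{q::rat. 0 \<le> q \<and> ereal (of_rat q) < a}. \<Inter>n::nat. \<Union>r::rat.
        {\<omega>\<in>space M. X (min (max 0 (of_rat r)) (of_rat q)) \<omega> < x + 1 / Suc n})"
    by auto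
  also have "\<dots> \<in> sets M"
    using meas by (intro sets.countable_UN' sets.countable_INT sets.countable_UN
        countableI_type borel_measurable_less borel_measurable_const image_subsetI) auto
  finally show "{\<omega>\<in>space M. hitting_time X x \<omega> < a} \<in> sets M" .
qed

lemma borel_measurable_hitting_time_solution:
  assumes "\<And>t. subalgebra M (F t)" and "solves_additive_sde M F B \<mu> \<sigma> x0 X"
  shows "hitting_time X x \<in> borel_measurable M"
  using assms unfolding solves_additive_sde_def
  by (intro borel_measurable_hitting_time) (auto intro: measurable_from_subalg)

text \<open>The drifts are compared at two different states, and only while the upper state
  \<open>p\<close> exceeds \<open>x\<close>: before \<open>X\<close> reaches \<open>x\<close>, its
  path provides just such a \<open>p\<close>.\<close>

lemma hitting_time_mono_AE:
  assumes X: "solves_additive_sde M F B \<mu> \<sigma> x0 X"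
    and Y: "solves_additive_sde M F B \<nu> \<sigma> x0 Y"
    and drift: "\<And>t p q. 0 \<le> t \<Longrightarrow> x < p \<Longrightarrow> q < p \<Longrightarrow> \<mu> t p \<le> \<nu> t q"
  shows "AE \<omega> in M. hitting_time X x \<omega> \<le> hitting_time Y x \<omega>"
proof -
  have "AE \<omega> in M. \<forall>t\<ge>0. set_integrable lborel {0..t} (\<lambda>s. \<mu> s (X s \<omega>)) \<and>
      X t \<omega> = x0 + (LBINT s:{0..t}. \<mu> s (X s \<omega>)) + \<sigma> * (B t \<omega> - B 0 \<omega>)"
    and "AE \<omega> in M. \<forall>t\<ge>0. set_integrable lborel {0..t} (\<lambda>s. \<nu> s (Y s \<omega>)) \<and>
      Y t \<omega> = x0 + (LBINT s:{0..t}. \<nu> s (Y s \<omega>)) + \<sigma> * (B t \<omega> - B 0 \<omega>)"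
    using X Y by (auto simp: solves_additive_sde_def)
  then show ?thesis
    using AE_space
  proof eventually_elim
    case (elim \<omega>)
    have contX: "continuous_on {0..} (\<lambda>t. X t \<omega>)" and contY: "continuous_on {0..} (\<lambda>t. Y t \<omega>)"
      using X Y elim(3) by (auto simp: solves_additive_sde_def)
    \<comment> \<open>Otherwise \<open>X\<close> stays above \<open>x\<close> on
      \<open>{0..t}\<close>, and comparison with the Brownian term as \<open>n\<close> yields the
      contradiction \<open>x < X t \<omega> \<le> Y t \<omega> \<le> x\<close>.\<close>
    have "\<exists>s\<in>{s. 0 \<le> s \<and> X s \<omega> \<le> x}. ereal s \<le> ereal t" if t: "0 \<le> t" "Y t \<omega> \<le> x" for t
    proof (rule ccontr)
      assume "\<not> ?thesis"
      then have above: "x < X s \<omega>" if "s \<in> {0..t}" for s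
        using that by force
      have "X t \<omega> \<le> Y t \<omega>"
      proof (rule integral_equation_comparison[where u = "\<lambda>s. X s \<omega>" and v = "\<lambda>s. Y s \<omega>"
              and f = "\<lambda>s. \<mu> s (X s \<omega>)" and g = "\<lambda>s. \<nu> s (Y s \<omega>)"])
        show "continuous_on {0..t} (\<lambda>t. X t \<omega>)" "continuous_on {0..t} (\<lambda>t. Y t \<omega>)"
          using contX contY by (auto elim: continuous_on_subset)
        show "\<mu> s (X s \<omega>) \<le> \<nu> s (Y s \<omega>)" if "s \<in> {0..t}" "Y s \<omega> < X s \<omega>" for s
          using that above by (intro drift) auto
      qed (use elim t in auto)
      then show False
        using above[of t] t by simp
    qed
    then show ?case
      unfolding hitting_time_def by (intro INF_mono) auto
  qed
qed

lemma stochastic_le_of_AE_le: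
  assumes "prob_space M" and X: "X \<in> borel_measurable M" and Y: "Y \<in> borel_measurable M"
    and le: "AE \<omega> in M. X \<omega> \<le> Y \<omega>"
  shows "stochastic_le M X M Y"
proof -
  interpret prob_space M by fact
  have "prob {\<omega>\<in>space M. X \<omega> > ereal t} \<le> prob {\<omega>\<in>space M. Y \<omega> > ereal t}" for t
  proof (rule finite_measure_mono_AE)
    show "AE \<omega> in M. \<omega> \<in> {\<omega>\<in>space M. X \<omega> > ereal t} \<longrightarrow> \<omega> \<in> {\<omega>\<in>space M. Y \<omega> > ereal t}"
      using le by eventually_elim auto
    show "{\<omega>\<in>space M. Y \<omega> > ereal t} \<in> sets M"
      using Y by measurable
  qed
  then show ?thesis
    using X Y by (simp add: stochastic_le_def)
qed

text \<open>First enlarge the denominator at the fixed state \<open>p\<close>, which uses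
  \<open>0 \<le> p\<close>; then lower the state to \<open>q\<close>, whose sign is
  arbitrary.\<close>

lemma arps_drift_mono:
  fixes d0 b1 b2 t p q :: real
  assumes "0 < d0" "0 \<le> b1" "b1 \<le> b2" "0 \<le> t" "0 \<le> p" "q \<le> p"
  shows "- (d0 * p / (1 + b1 * d0 * t)) \<le> - (d0 * q / (1 + b2 * d0 * t))"
proof -
  have "b1 * d0 * t \<le> b2 * d0 * t" and pos: "0 \<le> b1 * d0 * t"
    using assms by (auto intro!: mult_right_mono)
  then have "d0 * p / (1 + b2 * d0 * t) \<le> d0 * p / (1 + b1 * d0 * t)"
    using assms by (intro divide_left_mono mult_pos_pos add_pos_nonneg) auto
  moreover have "d0 * q / (1 + b2 * d0 * t) \<le> d0 * p / (1 + b2 * d0 * t)"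
    using assms by (intro divide_right_mono mult_left_mono) auto
  ultimately show ?thesis by simp
qed

theorem proposition4:
  fixes M :: "'a measure" and F :: "real \<Rightarrow> 'a measure" and B :: "real \<Rightarrow> 'a \<Rightarrow> real"
    and Q :: "real \<Rightarrow> real \<Rightarrow> 'a \<Rightarrow> real" and q0 d0 \<sigma> x b1 b2 :: real
  assumes "q0 > 0" and "d0 > 0" and "\<sigma> > 0"
    and "0 \<le> x" and "x < q0"
    and "standard_brownian_motion M F B"
    and "\<And>b. b \<in> {0..1} \<Longrightarrow>
           solves_additive_sde M F B (\<lambda>t q. - (d0 * q / (1 + b * d0 * t))) \<sigma> q0 (Q b)"
    and "b1 \<in> {0..1}" and "b2 \<in> {0..1}" and "b1 \<le> b2"
  shows "stochastic_le M (hitting_time (Q b1) x) M (hitting_time (Q b2) x)"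
proof -
  have ps: "prob_space M" and sub: "\<And>t. subalgebra M (F t)"
    using assms(6) by (auto simp: standard_brownian_motion_def)
  note sol1 = assms(7)[OF assms(8)] and sol2 = assms(7)[OF assms(9)]
  \<comment> \<open>Here \<open>0 \<le> x\<close> turns \<open>x < p\<close> into the nonnegativity
    of \<open>p\<close> that the drift comparison requires.\<close>
  have "AE \<omega> in M. hitting_time (Q b1) x \<omega> \<le> hitting_time (Q b2) x \<omega>"
    using assms(2,4,8,10) by (intro hitting_time_mono_AE[OF sol1 sol2] arps_drift_mono) auto
  then show ?thesis
    by (intro stochastic_le_of_AE_le ps borel_measurable_hitting_time_solution[OF sub sol1]
        borel_measurable_hitting_time_solution[OF sub sol2])
qed

end
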